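(* Let $\mu\in\mathbb{R}$, $\sigma>0$, $p\in(0,1)$, $\alpha\in\mathbb{R}\setminus\{0\}$, and suppose $Y\sim GAL(\mu,\sigma,p,\alpha)$. Let $y^{\ast}=(y-\mu)/\sigma$, $p_{\alpha_{+}}=p-I(\alpha>0)$ and $p_{\alpha_{-}}=p-I(\alpha<0)$. Then the cumulative distribution function $F$ of $Y$ is, for every $y\in\mathbb{R}$, $$ \begin{aligned} F(y)=\;&\Bigg(1-2\Phi\Big(-\frac{y^{\ast}}{|\alpha|}\Big)-\frac{2p(1-p)}{p_{\alpha_{-}}}\exp\Big\{-y^{\ast}p_{\alpha_{-}}+\tfrac12\alpha^2p_{\alpha_{-}}^2\Big\}\Big[\Phi\Big(\frac{y^{\ast}}{\alpha}-\alpha p_{\alpha_{-}}\Big)-\Phi\big(-\alpha p_{\alpha_{-}}\big)\Big]\Bigg)I\Big(\frac{y^{\ast}}{\alpha}>0\Big)\\ &+I(\alpha<0)-\frac{2p(1-p)}{p_{\alpha_{+}}}\exp\Big\{-y^{\ast}p_{\alpha_{+}}+\tfrac12\alpha^2p_{\alpha_{+}}^2\Big\}\,\Phi\Big(\alpha p_{\alpha_{+}}-\frac{y^{\ast}}{\alpha}I\Big(\frac{y^{\ast}}{\alpha}>0\Big)\Big). \end{aligned} $$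
   Context: $\Phi$ denotes the standard normal cumulative distribution function and $I(\cdot)$ the indicator function. The generalized asymmetric Laplace distribution $GAL(\mu,\sigma,p,\alpha)$ is the law of $$Y=\mu+\sigma A W+\sigma\alpha S+\sigma\,[BW]^{1/2}U,$$ where $W,S,U$ are mutually independent, $W$ is exponential with mean $1$, $S$ is half-normal $N^{+}(0,1)$ (density $\frac{2}{\sqrt{2\pi}}e^{-s^2/2}$ on $(0,\infty)$), $U\sim N(0,1)$, $A=\frac{1-2p}{p(1-p)}$ and $B=\frac{2}{p(1-p)}$. For $\alpha\ne0$ its probability density function is $$ \begin{aligned} f(y)=\frac{2p(1-p)}{\sigma}\Bigg(&\bigg[\Phi\Big(\frac{y^{\ast}}{\alpha}-\alpha p_{\alpha_{-}}\Big)-\Phi\big(-\alpha p_{\alpha_{-}}\big)\bigg]\exp\Big\{-y^{\ast}p_{\alpha_{-}}+\tfrac12\big(\alpha p_{\alpha_{-}}\big)^2\Big\}\,I\Big(\frac{y^{\ast}}{\alpha}>0\Big)\\ &+\Phi\Big(\alpha p_{\alpha_{+}}-\frac{y^{\ast}}{\alpha}I\Big(\frac{y^{\ast}}{\alpha}>0\Big)\Big)\exp\Big\{-y^{\ast}p_{\alpha_{+}}+\tfrac12\big(\alpha p_{\alpha_{+}}\big)^2\Big\}\Bigg), \end{aligned} $$ with $y^{\ast}=(y-\mu)/\sigma$, $p_{\alpha_{+}}=p-I(\alpha>0)$, $p_{\alpha_{-}}=p-I(\alpha<0)$. *)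

theory Defs
  imports "HOL-Probability.Probability"
begin

definition Phi :: "real \<Rightarrow> real" where
  "Phi x = cdf std_normal_distribution x"

definition half_normal_density :: "real \<Rightarrow> real" where
  "half_normal_density s = (if s > 0 then 2 / sqrt (2 * pi) * exp (- s\<^sup>2 / 2) else 0)"

definition GAL_A :: "real \<Rightarrow> real" where
  "GAL_A p = (1 - 2 * p) / (p * (1 - p))"

definition GAL_B :: "real \<Rightarrow> real" where
  "GAL_B p = 2 / (p * (1 - p))"

definition GAL_map :: "real \<Rightarrow> real \<Rightarrow> real \<Rightarrow> real \<Rightarrow> real \<Rightarrow> real \<Rightarrow> real \<Rightarrow> real" where
  "GAL_map \<mu> \<sigma> p \<alpha> w s u =
     \<mu> + \<sigma> * GAL_A p * w + \<sigma> * \<alpha> * s + \<sigma> * sqrt (GAL_B p * w) * u"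

text \<open>
  The law of \<open>GAL_map \<mu> \<sigma> p \<alpha> W S U\<close>. Mutual independence of \<open>W\<close>, \<open>S\<close>, \<open>U\<close> is encoded by
  taking the product of their laws as the joint law; \<open>GAL_eq_distr\<close> below is the version
  for random variables on an arbitrary probability space.
\<close>

definition GAL :: "real \<Rightarrow> real \<Rightarrow> real \<Rightarrow> real \<Rightarrow> real measure" where
  "GAL \<mu> \<sigma> p \<alpha> =
     distr (density lborel (exponential_density 1) \<Otimes>\<^sub>M
            (density lborel half_normal_density \<Otimes>\<^sub>M std_normal_distribution))
       borel (\<lambda>(w, s, u). GAL_map \<mu> \<sigma> p \<alpha> w s u)"

lemma (in prob_space) distr_pair_of_indep_var:
  fixes f :: "'b \<Rightarrow> 'c" and g :: "'b \<Rightarrow> 'd"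
  assumes XZ: "indep_var N1 X N2 Z"
    and f [measurable]: "f \<in> N1 \<rightarrow>\<^sub>M K1" and g [measurable]: "g \<in> N2 \<rightarrow>\<^sub>M K2"
  shows "distr M (K1 \<Otimes>\<^sub>M K2) (\<lambda>x. (f (X x), g (Z x))) =
         distr M K1 (\<lambda>x. f (X x)) \<Otimes>\<^sub>M distr M K2 (\<lambda>x. g (Z x))"
proof -
  have m [measurable]: "X \<in> M \<rightarrow>\<^sub>M N1" "Z \<in> M \<rightarrow>\<^sub>M N2"
    using indep_var_rv1[OF XZ] indep_var_rv2[OF XZ] by auto
  interpret K2: prob_space "distr (distr M N2 Z) K2 g"
    by (intro prob_space.prob_space_distr prob_space_distr) measurable
  have "distr M K1 (\<lambda>x. f (X x)) \<Otimes>\<^sub>M distr M K2 (\<lambda>x. g (Z x)) =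
      distr (distr M N1 X) K1 f \<Otimes>\<^sub>M distr (distr M N2 Z) K2 g"
    by (simp add: distr_distr comp_def)
  also have "\<dots> = distr (distr M N1 X \<Otimes>\<^sub>M distr M N2 Z) (K1 \<Otimes>\<^sub>M K2) (\<lambda>(x, z). (f x, g z))"
    by (rule pair_measure_distr) (use K2.sigma_finite_measure_axioms in auto)
  also have "distr M N1 X \<Otimes>\<^sub>M distr M N2 Z = distr M (N1 \<Otimes>\<^sub>M N2) (\<lambda>x. (X x, Z x))"
    using XZ by (simp add: indep_var_distribution_eq)
  also have "distr \<dots> (K1 \<Otimes>\<^sub>M K2) (\<lambda>(x, z). (f x, g z)) =
      distr M (K1 \<Otimes>\<^sub>M K2) (\<lambda>x. (f (X x), g (Z x)))"
    by (subst distr_distr) (auto simp: comp_def)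
  finally show ?thesis ..
qed

lemma (in prob_space) GAL_eq_distr:
  fixes W S U :: "'a \<Rightarrow> real"
  assumes W: "distributed M lborel W (exponential_density 1)"
    and S: "distributed M lborel S half_normal_density"
    and U: "distributed M lborel U std_normal_density"
    and indep: "indep_vars (\<lambda>_. borel) (\<lambda>i. [W, S, U] ! i) {0, 1, 2 :: nat}"
  shows "GAL \<mu> \<sigma> p \<alpha> = distr M borel (\<lambda>x. GAL_map \<mu> \<sigma> p \<alpha> (W x) (S x) (U x))"
proof -
  have m [measurable]: "W \<in> borel_measurable M" "S \<in> borel_measurable M" "U \<in> borel_measurable M"
    using distributed_measurable[OF W] distributed_measurable[OF S] distributed_measurable[OF U]
    by simp_all
  have g [measurable]: "(\<lambda>(w, s, u). GAL_map \<mu> \<sigma> p \<alpha> w s u) \<in> borel_measurable (borel \<Otimes>\<^sub>M (borel \<Otimes>\<^sub>M borel))"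
    unfolding GAL_map_def by measurable
  have l: "distr M borel X = distr M lborel X" for X :: "'a \<Rightarrow> real"
    by (rule distr_cong) auto
  have "distr M borel W = density lborel (exponential_density 1)"
    "distr M borel S = density lborel half_normal_density"
    "distr M borel U = std_normal_distribution"
    unfolding l using W S U by (auto simp: distributed_distr_eq_density)
  moreover let ?R = "\<lambda>J x. \<lambda>i\<in>J. ([W, S, U] ! i) x"
  have "distr M (borel \<Otimes>\<^sub>M borel) (\<lambda>x. (S x, U x)) = distr M borel S \<Otimes>\<^sub>M distr M borel U"
  proof -
    have R: "indep_var (PiM {1} (\<lambda>_. borel)) (?R {1}) (PiM {2} (\<lambda>_. borel)) (?R {2})"
      by (rule indep_var_restrict[OF indep]) auto
    have f: "(\<lambda>h. h i) \<in> PiM {i :: nat} (\<lambda>_. borel :: real measure) \<rightarrow>\<^sub>M borel" for i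
      by measurable
    show ?thesis
      using distr_pair_of_indep_var[OF R f f] by simp
  qed
  moreover have "distr M (borel \<Otimes>\<^sub>M (borel \<Otimes>\<^sub>M borel)) (\<lambda>x. (W x, S x, U x)) =
      distr M borel W \<Otimes>\<^sub>M distr M (borel \<Otimes>\<^sub>M borel) (\<lambda>x. (S x, U x))"
  proof -
    have R: "indep_var (PiM {0} (\<lambda>_. borel)) (?R {0}) (PiM {1, 2} (\<lambda>_. borel)) (?R {1, 2})"
      by (rule indep_var_restrict[OF indep]) auto
    have f: "(\<lambda>h. h 0) \<in> PiM {0 :: nat} (\<lambda>_. borel :: real measure) \<rightarrow>\<^sub>M borel"
      by measurable
    have g: "(\<lambda>h. (h 1, h 2)) \<in> PiM {1, 2 :: nat} (\<lambda>_. borel :: real measure) \<rightarrow>\<^sub>M borel \<Otimes>\<^sub>M borel"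
      by measurable
    show ?thesis
      using distr_pair_of_indep_var[OF R f g] by simp
  qed
  ultimately have "GAL \<mu> \<sigma> p \<alpha> = distr (distr M (borel \<Otimes>\<^sub>M (borel \<Otimes>\<^sub>M borel)) (\<lambda>x. (W x, S x, U x)))
      borel (\<lambda>(w, s, u). GAL_map \<mu> \<sigma> p \<alpha> w s u)"
    by (simp add: GAL_def)
  also have "\<dots> = distr M borel (\<lambda>x. GAL_map \<mu> \<sigma> p \<alpha> (W x) (S x) (U x))"
    by (subst distr_distr) (auto simp: comp_def)
  finally show ?thesis .
qed

end

theory Submission
  imports Defs
begin

text \<open>
  The sum \<open>A W + sqrt (B W) U\<close> has an asymmetric Laplace law, since both characteristic
  functions equal \<open>1 / (1 + B t\<^sup>2 / 2 - i A t)\<close>. By Fubini, the distribution function of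
  \<open>(Y - \<mu>) / \<sigma>\<close> at \<open>x\<close> is then the asymmetric Laplace distribution function averaged at
  \<open>x - \<alpha> S\<close>. On each side of \<open>S = x / \<alpha>\<close> that function is affine in an exponential of
  \<open>S\<close>, so completing the square reduces the average to Gaussian tails.
\<close>

section \<open>Exponential integrals over half-lines\<close>

text \<open>The modulus of the integrand is a real exponential of rate \<open>Re c > 0\<close>,
  which gives integrability. The antiderivative \<open>- exp (- c * x) / c\<close> vanishes at
  infinity for the same reason, so the fundamental theorem leaves only its value at
  \<open>a\<close>. Complex rates are what the characteristic functions below require.\<close>

lemma has_bochner_integral_exp_tail_complex:
  fixes c :: complex and a :: real
  assumes "0 < Re c"
  shows "has_bochner_integral lborel (\<lambda>x. indicator {a<..} x *\<^sub>R exp (- c * of_real x))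
    (exp (- c * of_real a) / c)"
proof -
  let ?f = "\<lambda>x :: real. exp (- c * of_real x)" and ?F = "\<lambda>x :: real. - exp (- c * of_real x) / c"
  have c: "c \<noteq> 0" using assms by auto
  have int: "set_integrable lborel {a<..} ?f"
  proof -
    have "set_integrable lborel {0<..} (\<lambda>x. exp (- (x * Re c)))"
      by (rule integrable_I0i_exp_mscale) fact
    then have "integrable lborel (\<lambda>x. indicator {0<..} x * exp (- (x * Re c)))"
      by (simp add: set_integrable_def)
    \<comment> \<open>Translation by \<open>a\<close> carries the half-line from 0 to the half-line
      from \<open>a\<close>; the factor \<open>exp (- a * Re c)\<close> compensates for the shifted
      exponent.\<close>
    from lborel_integrable_real_affine[OF this, of 1 "-a"]
    have "integrable lborel (\<lambda>x. exp (- a * Re c) * (indicator {0<..} (x - a) * exp (- ((x - a) * Re c))))"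
      by simp
    also have "(\<lambda>x. exp (- a * Re c) * (indicator {0<..} (x - a) * exp (- ((x - a) * Re c)))) =
        (\<lambda>x. indicator {a<..} x * exp (- Re c * x))"
      by (auto simp: fun_eq_iff indicator_def algebra_simps simp flip: exp_add)
    finally have "integrable lborel (\<lambda>x. indicator {a<..} x * exp (- Re c * x))" .
    then show ?thesis
      unfolding set_integrable_def
      by (rule Bochner_Integration.integrable_bound) (auto simp: indicator_def)
  qed
  have "(LBINT x=ereal a..\<infinity>. ?f x) = 0 - ?F a"
  proof (rule interval_integral_FTC_integrable)
    show "(?F has_vector_derivative ?f x) (at x)" for x
      using c by (auto intro!: derivative_eq_intros has_vector_derivative_real_field)
    show "isCont ?f x" for x by (intro continuous_intros)
    show "set_integrable lborel (einterval (ereal a) \<infinity>) ?f" using int by simp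
    show "((?F \<circ> real_of_ereal) \<longlongrightarrow> ?F a) (at_right (ereal a))"
      unfolding ereal_tendsto_simps
      by (intro tendsto_intros c)
    have "((\<lambda>x. norm (?F x)) \<longlongrightarrow> 0) at_top"
    proof -
      have "((\<lambda>x. exp (- Re c * x)) \<longlongrightarrow> 0) at_top"
        using assms by (intro filterlim_compose[OF exp_at_bot]
            filterlim_tendsto_neg_mult_at_bot[OF tendsto_const] filterlim_ident) auto
      from tendsto_divide_zero[OF this] show ?thesis
        by (simp add: norm_divide)
    qed
    then show "((?F \<circ> real_of_ereal) \<longlongrightarrow> 0) (at_left \<infinity>)"
      unfolding ereal_tendsto_simps by (rule tendsto_norm_zero_cancel)
  qed simp
  then show ?thesis
    using int by (simp add: has_bochner_integral_iff interval_integral_to_infinity_eq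
        set_integrable_def set_lebesgue_integral_def)
qed

lemma has_bochner_integral_exp_tail:
  fixes a c :: real
  assumes "0 < c"
  shows "has_bochner_integral lborel (\<lambda>x. indicator {a<..} x * exp (- c * x)) (exp (- c * a) / c)"
proof -
  have Re: "Re (exp (- complex_of_real c * complex_of_real x)) = exp (- c * x)" for x
    by (simp flip: of_real_mult of_real_minus add: exp_of_real)
  have "has_bochner_integral lborel
      (\<lambda>x. Re (indicator {a<..} x *\<^sub>R exp (- complex_of_real c * complex_of_real x)))
      (Re (exp (- complex_of_real c * complex_of_real a) / complex_of_real c))"
    using assms by (intro has_bochner_integral_bounded_linear[OF bounded_linear_Re]
        has_bochner_integral_exp_tail_complex) simp
  then show ?thesis
    by (simp only: Re_divide_of_real scaleR_complex.sel Re)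
qed

text \<open>The endpoint is a null set. The closed form is needed because reflecting
  \<open>{..x}\<close> gives the closed half-line \<open>{-x..}\<close>.\<close>

lemma has_bochner_integral_exp_tail_closed:
  fixes a c :: real
  assumes "0 < c"
  shows "has_bochner_integral lborel (\<lambda>x. indicator {a..} x * exp (- c * x)) (exp (- c * a) / c)"
  using has_bochner_integral_exp_tail[OF assms, of a]
  by (rule has_bochner_integral_discrete_difference[where X="{a}", THEN iffD1, rotated -1])
    (auto simp: indicator_def)

section \<open>Gaussian tail integrals and the symmetry of \<open>Phi\<close>\<close>

lemma has_bochner_integral_reflect:
  fixes f :: "real \<Rightarrow> 'b :: {banach, second_countable_topology}"
  shows "has_bochner_integral lborel f x \<Longrightarrow> has_bochner_integral lborel (\<lambda>s. f (b - s)) x"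
  using lborel_has_bochner_integral_real_affine_iff[of "-1" f x b] by simp

lemma has_bochner_integral_std_normal_atMost:
  "has_bochner_integral lborel (\<lambda>x. indicator {..t} x * std_normal_density x) (Phi t)"
proof -
  interpret N: prob_space std_normal_distribution
    by (rule prob_space_normal_density) simp
  have i: "integrable lborel (\<lambda>x. std_normal_density x * indicator {..t} x)"
    by (intro integrable_real_mult_indicator integrable_normal_density) auto
  have "Phi t = (LINT x|std_normal_distribution. indicator {..t} x)"
    by (simp add: Phi_def cdf_def)
  also have "\<dots> = (LINT x|lborel. std_normal_density x * indicator {..t} x)"
    by (subst integral_density) auto
  finally show ?thesis
    using i by (simp add: has_bochner_integral_iff mult.commute)
qed

text \<open>Completing the square, b s - s^2/2 = b^2/2 - (b - s)^2/2, and the reflection of s to b -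
  s sends \<open>{t..}\<close> to \<open>{..b - t}\<close>. Every Gaussian term of the final formula
  is an instance; b = 0 gives the plain upper tail.\<close>

lemma has_bochner_integral_tilted_std_normal_tail:
  "has_bochner_integral lborel (\<lambda>s. indicator {t..} s * (exp (b * s) * std_normal_density s))
     (exp (b\<^sup>2 / 2) * Phi (b - t))"
proof -
  have eq: "indicator {t..} s * (exp (b * s) * std_normal_density s) =
      exp (b\<^sup>2 / 2) * (indicator {..b - t} (b - s) * std_normal_density (b - s))" for s
  proof -
    have "exp (b * s) * exp (- s\<^sup>2 / 2) = exp (b\<^sup>2 / 2) * exp (- (b - s)\<^sup>2 / 2)"
      by (simp add: power2_eq_square field_simps flip: exp_add)
    then show ?thesis
      by (auto simp: std_normal_density_def indicator_def)
  qed
  show ?thesis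
    unfolding eq
    by (intro has_bochner_integral_mult_right has_bochner_integral_reflect has_bochner_integral_std_normal_atMost)
qed

text \<open>The half-lines \<open>{..t}\<close> and \<open>{t..}\<close> cover the line and overlap
  only in the null set {t}, so their masses \<open>Phi t\<close> and \<open>Phi (- t)\<close> add up
  to 1.\<close>

lemma Phi_minus: "Phi (- t) = 1 - Phi t"
proof -
  have "has_bochner_integral lborel (\<lambda>s. indicator {..t} s * std_normal_density s
     + indicator {t..} s * (exp (0 * s) * std_normal_density s)) (Phi t + exp (0\<^sup>2 / 2) * Phi (0 - t))"
    by (intro has_bochner_integral_add has_bochner_integral_std_normal_atMost has_bochner_integral_tilted_std_normal_tail)
  then have "has_bochner_integral lborel std_normal_density (Phi t + exp (0\<^sup>2 / 2) * Phi (0 - t))"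
    by (rule has_bochner_integral_discrete_difference[where X="{t}", THEN iffD1, rotated -1])
      (auto simp: indicator_def)
  then show ?thesis
    using integral_normal_density[of 1 0] by (simp add: has_bochner_integral_iff)
qed

section \<open>The asymmetric Laplace law as an exponential-normal mixture\<close>

text \<open>Rate p to the right of 0 and rate 1 - p to the left, so that 0 is the p-quantile. Both
  branches live on open half-lines and the value at 0 is 0, which affects no integral.\<close>

definition asym_laplace_density :: "real \<Rightarrow> real \<Rightarrow> real" where
  "asym_laplace_density p x =
     p * (1 - p) * (indicator {0<..} x * exp (- p * x) + indicator {0<..} (- x) * exp ((1 - p) * x))"

definition asym_laplace_cdf :: "real \<Rightarrow> real \<Rightarrow> real" where
  "asym_laplace_cdf p x = (if x \<ge> 0 then 1 - (1 - p) * exp (- p * x) else p * exp ((1 - p) * x))"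

text \<open>What remains of (Y - \<mu>) / \<sigma> once the half-normal term is removed.\<close>

definition exponential_normal_mixture :: "real \<Rightarrow> real measure" where
  "exponential_normal_mixture p =
     distr (density lborel (exponential_density 1) \<Otimes>\<^sub>M std_normal_distribution) borel
       (\<lambda>(w, u). GAL_A p * w + sqrt (GAL_B p * w) * u)"

lemma asym_laplace_density_measurable [measurable]: "asym_laplace_density p \<in> borel_measurable borel"
  unfolding asym_laplace_density_def by measurable

lemma asym_laplace_density_nonneg: "0 < p \<Longrightarrow> p < 1 \<Longrightarrow> 0 \<le> asym_laplace_density p x"
  by (simp add: asym_laplace_density_def)

lemma has_bochner_integral_asym_laplace_density:
  assumes "0 < p" "p < 1"
  shows "has_bochner_integral lborel (asym_laplace_density p) 1"
proof -
  \<comment> \<open>Writing \<open>0 - x\<close> turns the left branch into a reflected right tail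
    of rate 1 - p. The two branches have masses 1 - p and p.\<close>
  have "has_bochner_integral lborel
      (\<lambda>x. p * (1 - p) * (indicator {0<..} x * exp (- p * x) + indicator {0<..} (0 - x) * exp (- (1 - p) * (0 - x))))
      (p * (1 - p) * (exp (- p * 0) / p + exp (- (1 - p) * 0) / (1 - p)))"
    by (intro has_bochner_integral_mult_right has_bochner_integral_add
        has_bochner_integral_exp_tail
        has_bochner_integral_reflect[where b=0 and f="\<lambda>x. indicator {0<..} x * exp (- (1 - p) * x)"])
      (use assms in auto)
  moreover have "p * (1 - p) * (exp (- p * 0) / p + exp (- (1 - p) * 0) / (1 - p)) = 1"
    using assms by (simp add: field_simps)
  ultimately show ?thesis
    by (simp add: asym_laplace_density_def [abs_def] algebra_simps)
qed

lemma real_distribution_asym_laplace: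
  assumes "0 < p" "p < 1"
  shows "real_distribution (density lborel (asym_laplace_density p))"
proof -
  have "(\<integral>\<^sup>+x. ennreal (asym_laplace_density p x) \<partial>lborel) = ennreal 1"
    using has_bochner_integral_asym_laplace_density[OF assms] asym_laplace_density_nonneg[OF assms]
    by (subst nn_integral_eq_integral) (auto simp: has_bochner_integral_iff)
  then have "prob_space (density lborel (asym_laplace_density p))"
    by (intro prob_spaceI) (simp add: emeasure_density)
  then show ?thesis
    by (simp add: real_distribution_def real_distribution_axioms_def)
qed

text \<open>Multiplying by \<open>iexp (t * x)\<close> only changes the rates, to p - it on the
  right and 1 - p + it on the left. Their real parts stay positive, so each branch is a complex
  exponential tail.\<close>

lemma char_asym_laplace:
  assumes p: "0 < p" "p < 1"
  shows "char (density lborel (asym_laplace_density p)) t =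
     p * (1 - p) * (1 / (p - \<i> * t) + 1 / (1 - p + \<i> * t))"
proof -
  let ?a = "p - \<i> * t" and ?b = "1 - p + \<i> * t"
  have eq: "asym_laplace_density p x *\<^sub>R iexp (t * x) =
      p * (1 - p) * (indicator {0<..} x *\<^sub>R exp (- ?a * of_real x)
        + indicator {0<..} (0 - x) *\<^sub>R exp (- ?b * of_real (0 - x)))" for x
  proof -
    have "of_real (exp (- p * x)) * iexp (t * x) = exp (- ?a * of_real x)"
      by (simp add: algebra_simps exp_of_real[symmetric] flip: exp_add)
    moreover have "of_real (exp ((1 - p) * x)) * iexp (t * x) = exp (- ?b * of_real (0 - x))"
      by (simp add: algebra_simps exp_of_real[symmetric] flip: exp_add)
    ultimately show ?thesis
      by (cases "x > 0"; cases "x < 0") (auto simp: asym_laplace_density_def scaleR_conv_of_real mult.assoc)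
  qed
  have "has_bochner_integral lborel (\<lambda>x. asym_laplace_density p x *\<^sub>R iexp (t * x))
     (p * (1 - p) * (exp (- ?a * of_real 0) / ?a + exp (- ?b * of_real 0) / ?b))"
    unfolding eq
    by (intro has_bochner_integral_mult_right has_bochner_integral_add
        has_bochner_integral_exp_tail_complex
        has_bochner_integral_reflect[where b=0 and f="\<lambda>x. indicator {0<..} x *\<^sub>R exp (- ?b * of_real x)"])
      (use p in auto)
  then show ?thesis
    unfolding char_def
    by (subst integral_density) (auto simp: asym_laplace_density_nonneg p has_bochner_integral_iff)
qed

text \<open>Equality of characteristic functions suffices. Conditioning on W leaves a normal
  characteristic function, and integrating over W then gives an exponential integral of complex rate
  \<open>?c\<close>.\<close>

lemma exponential_normal_mixture_eq:
  assumes p: "0 < p" "p < 1"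
  shows "exponential_normal_mixture p = density lborel (asym_laplace_density p)"
proof (rule Levy_uniqueness)
  let ?E = "density lborel (exponential_density 1)" and ?N = std_normal_distribution
  let ?g = "\<lambda>(w, u). GAL_A p * w + sqrt (GAL_B p * w) * u"
  interpret E: prob_space ?E by (rule prob_space_exponential_density) simp
  interpret N: prob_space ?N by (rule prob_space_normal_density) simp
  interpret P: pair_prob_space ?E ?N ..
  show "real_distribution (exponential_normal_mixture p)"
    unfolding exponential_normal_mixture_def by (rule P.real_distribution_distr) measurable
  show "real_distribution (density lborel (asym_laplace_density p))"
    using p by (rule real_distribution_asym_laplace)
  show "char (exponential_normal_mixture p) = char (density lborel (asym_laplace_density p))"
  proof
    fix t :: real
    let ?c = "1 + t\<^sup>2 * GAL_B p / 2 - \<i> * (t * GAL_A p)"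
    have B: "GAL_B p > 0" using p by (simp add: GAL_B_def)
    have int: "integrable (?E \<Otimes>\<^sub>M ?N) (\<lambda>z. iexp (t * ?g z))"
      by (rule P.integrable_const_bound[where B=1]) auto
    have "char (exponential_normal_mixture p) t = (CLINT z|?E \<Otimes>\<^sub>M ?N. iexp (t * ?g z))"
      unfolding char_def exponential_normal_mixture_def by (subst integral_distr) auto
    also have "\<dots> = (CLINT w|?E. CLINT u|?N. iexp (t * ?g (w, u)))"
      by (rule P.integral_fst'[OF int, symmetric])
    \<comment> \<open>For fixed w the phase of \<open>GAL_A p * w\<close> factors out, and the rest
      is the standard normal characteristic function at
      \<open>t * sqrt (GAL_B p * w)\<close>.\<close>
    also have "(\<lambda>w. CLINT u|?N. iexp (t * ?g (w, u))) =
        (\<lambda>w. iexp (t * GAL_A p * w) * exp (- ((t * sqrt (GAL_B p * w))\<^sup>2) / 2))"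
    proof
      fix w
      have "(CLINT u|?N. iexp (t * ?g (w, u))) =
          (CLINT u|?N. iexp (t * GAL_A p * w) * iexp ((t * sqrt (GAL_B p * w)) * u))"
        by (simp add: algebra_simps flip: exp_add)
      also have "\<dots> = iexp (t * GAL_A p * w) * char ?N (t * sqrt (GAL_B p * w))"
        by (simp add: char_def)
      finally show "(CLINT u|?N. iexp (t * ?g (w, u))) =
          iexp (t * GAL_A p * w) * exp (- ((t * sqrt (GAL_B p * w))\<^sup>2) / 2)"
        by (simp add: char_std_normal_distribution)
    qed
    also have "(CLINT w|?E. iexp (t * GAL_A p * w) * exp (- ((t * sqrt (GAL_B p * w))\<^sup>2) / 2)) =
        (CLINT w|lborel. exponential_density 1 w *\<^sub>R (iexp (t * GAL_A p * w) * exp (- ((t * sqrt (GAL_B p * w))\<^sup>2) / 2)))"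
      by (subst integral_density) (auto simp: exponential_density_nonneg)
    also have "\<dots> = (CLINT w|lborel. indicator {0<..} w *\<^sub>R exp (- ?c * of_real w))"
    \<comment> \<open>\<open>exponential_density 1\<close> equals 1 at 0, whereas the indicator is
      that of the open half-line; the integrands differ at this point only.\<close>
    proof (rule integral_discrete_difference[where X="{0}"])
      fix w :: real assume "w \<notin> {0}"
      show "exponential_density 1 w *\<^sub>R (iexp (t * GAL_A p * w) * exp (- ((t * sqrt (GAL_B p * w))\<^sup>2) / 2)) =
          indicator {0<..} w *\<^sub>R exp (- ?c * of_real w)"
      proof (cases "w > 0")
        case True
        then show ?thesis using B
          by (simp add: exponential_density_def scaleR_conv_of_real power_mult_distrib
              algebra_simps exp_of_real[symmetric] flip: exp_add)
      next
        case False
        then show ?thesis using \<open>w \<notin> {0}\<close> by (simp add: exponential_density_def)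
      qed
    qed auto
    also have "\<dots> = 1 / ?c"
    proof -
      have "0 < Re ?c" using B by (simp add: add_pos_nonneg)
      from has_bochner_integral_exp_tail_complex[OF this, of 0] show ?thesis
        by (simp add: has_bochner_integral_iff)
    qed
    also have "\<dots> = p * (1 - p) * (1 / (p - \<i> * t) + 1 / (1 - p + \<i> * t))"
    proof -
      let ?q = "complex_of_real (p * (1 - p))"
      have nz: "?q \<noteq> 0" "p - \<i> * t \<noteq> 0" "1 - p + \<i> * t \<noteq> 0"
        using p by (auto simp: complex_eq_iff)
      \<comment> \<open>Multiplying \<open>?c\<close> by p(1 - p) clears the denominators of A and
        B, and the result factors as (p - it)(1 - p + it). These two factors sum to 1, so the
        partial fractions have equal numerators.\<close>
      have "?q * (t\<^sup>2 * GAL_B p / 2) = of_real (t\<^sup>2)" "?q * (t * GAL_A p) = of_real (t * (1 - 2 * p))"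
        unfolding of_real_mult[symmetric] of_real_eq_iff GAL_A_def GAL_B_def using p by (simp_all add: field_simps)
      moreover have "q * (1 + X - \<i> * Y) = q + q * X - \<i> * (q * Y)" for q X Y :: complex
        by (simp add: algebra_simps)
      ultimately have "?q * ?c = ?q + of_real (t\<^sup>2) - \<i> * of_real (t * (1 - 2 * p))"
        by (simp only: of_real_mult of_real_add of_real_1)
      also have "\<dots> = (p - \<i> * t) * (1 - p + \<i> * t)"
        by (simp add: algebra_simps power2_eq_square)
      finally have c: "?c = (p - \<i> * t) * (1 - p + \<i> * t) / ?q"
        using nz by (simp add: field_simps)
      show ?thesis
        unfolding c using nz by (simp add: field_simps)
    qed
    also have "\<dots> = char (density lborel (asym_laplace_density p)) t"
      using char_asym_laplace[OF p] by simp
    finally show "char (exponential_normal_mixture p) t = char (density lborel (asym_laplace_density p)) t" .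
  qed
qed

text \<open>For x at least 0 the right tail beyond x is subtracted from the total mass 1; for
  negative x only the left branch contributes, and it is integrated after reflection.\<close>

lemma measure_asym_laplace_atMost:
  assumes p: "0 < p" "p < 1"
  shows "measure (density lborel (asym_laplace_density p)) {..x} = asym_laplace_cdf p x"
proof -
  let ?d = "asym_laplace_density p"
  have "measure (density lborel ?d) {..x} = (LINT y|lborel. ?d y * indicator {..x} y)"
    using integral_density[of "indicator {..x} :: real \<Rightarrow> real" lborel ?d]
    by (simp add: asym_laplace_density_nonneg p)
  also have "has_bochner_integral lborel (\<lambda>y. ?d y * indicator {..x} y) (asym_laplace_cdf p x)"
  proof (cases "x \<ge> 0")
    case True
    have "has_bochner_integral lborel (\<lambda>y. ?d y - p * (1 - p) * (indicator {x<..} y * exp (- p * y)))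
        (1 - p * (1 - p) * (exp (- p * x) / p))"
      using p by (intro has_bochner_integral_diff has_bochner_integral_mult_right
          has_bochner_integral_exp_tail has_bochner_integral_asym_laplace_density)
    also have "(\<lambda>y. ?d y - p * (1 - p) * (indicator {x<..} y * exp (- p * y))) = (\<lambda>y. ?d y * indicator {..x} y)"
      using True by (auto simp: fun_eq_iff asym_laplace_density_def indicator_def)
    finally show ?thesis
      using p True by (simp add: asym_laplace_cdf_def)
  next
    case False
    have "has_bochner_integral lborel (\<lambda>y. p * (1 - p) * (indicator {-x..} (0 - y) * exp (- (1 - p) * (0 - y))))
        (p * (1 - p) * (exp (- (1 - p) * (- x)) / (1 - p)))"
      using p by (intro has_bochner_integral_mult_right has_bochner_integral_exp_tail_closed
          has_bochner_integral_reflect[where b=0 and f="\<lambda>y. indicator {-x..} y * exp (- (1 - p) * y)"]) auto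
    also have "(\<lambda>y. p * (1 - p) * (indicator {-x..} (0 - y) * exp (- (1 - p) * (0 - y)))) = (\<lambda>y. ?d y * indicator {..x} y)"
      using False by (auto simp: fun_eq_iff asym_laplace_density_def indicator_def algebra_simps)
    also have "p * (1 - p) * (exp (- (1 - p) * (- x)) / (1 - p)) = asym_laplace_cdf p x"
      using p False by (simp add: asym_laplace_cdf_def) (simp add: algebra_simps)
    finally show ?thesis .
  qed
  then have "(LINT y|lborel. ?d y * indicator {..x} y) = asym_laplace_cdf p x"
    by (rule has_bochner_integral_integral_eq)
  finally show ?thesis .
qed

section \<open>The half-normal law and the reduction to a single integral\<close>

lemma half_normal_density_eq: "half_normal_density s = 2 * (indicator {0<..} s * std_normal_density s)"
  by (simp add: half_normal_density_def std_normal_density_def)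

lemma half_normal_density_measurable [measurable]: "half_normal_density \<in> borel_measurable borel"
  unfolding half_normal_density_eq [abs_def] by measurable

lemma half_normal_density_nonneg: "0 \<le> half_normal_density s"
  by (simp add: half_normal_density_eq)

lemma Phi_0: "Phi 0 = 1 / 2"
  using Phi_minus[of 0] by simp

lemma prob_space_half_normal: "prob_space (density lborel half_normal_density)"
proof -
  have "has_bochner_integral lborel
      (\<lambda>s. 2 * (indicator {0..} s * (exp (0 * s) * std_normal_density s))) (2 * (exp (0\<^sup>2 / 2) * Phi (0 - 0)))"
    by (intro has_bochner_integral_mult_right has_bochner_integral_tilted_std_normal_tail)
  then have "has_bochner_integral lborel half_normal_density (2 * (exp (0\<^sup>2 / 2) * Phi (0 - 0)))"
    by (rule has_bochner_integral_discrete_difference[where X="{0}", THEN iffD1, rotated -1])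
      (auto simp: indicator_def half_normal_density_eq)
  then have "(\<integral>\<^sup>+s. ennreal (half_normal_density s) \<partial>lborel) = ennreal 1"
    by (subst nn_integral_eq_integral) (auto simp: has_bochner_integral_iff half_normal_density_nonneg Phi_0)
  then show ?thesis
    by (intro prob_spaceI) (simp add: emeasure_density)
qed

lemma asym_laplace_cdf_measurable [measurable]: "asym_laplace_cdf p \<in> borel_measurable borel"
  unfolding asym_laplace_cdf_def by measurable

text \<open>For fixed s the event says that the mixture of W and U is at most (y - \<mu>) / \<sigma>
  - \<alpha> s, whose probability is \<open>asym_laplace_cdf\<close>. The integrals of indicators
  are nonnegative, so Fubini asks only for measurability.\<close>

lemma emeasure_GAL_atMost:
  assumes p: "0 < p" "p < 1" and \<sigma>: "\<sigma> > 0"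
  shows "emeasure (GAL \<mu> \<sigma> p \<alpha>) {..y} =
     (\<integral>\<^sup>+s. ennreal (half_normal_density s * asym_laplace_cdf p ((y - \<mu>) / \<sigma> - \<alpha> * s)) \<partial>lborel)"
proof -
  let ?E = "density lborel (exponential_density 1)" and ?N = std_normal_distribution
    and ?H = "density lborel half_normal_density"
  let ?g = "\<lambda>(w, u). GAL_A p * w + sqrt (GAL_B p * w) * u"
  let ?I = "\<lambda>w s u. indicator {..y} (GAL_map \<mu> \<sigma> p \<alpha> w s u) :: ennreal"
  interpret E: prob_space ?E by (rule prob_space_exponential_density) simp
  interpret N: prob_space ?N by (rule prob_space_normal_density) simp
  interpret H: prob_space ?H by (rule prob_space_half_normal)
  interpret HN: pair_prob_space ?H ?N ..
  interpret EH: pair_prob_space ?E ?H ..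
  have [measurable (raw)]: "(\<lambda>x. GAL_map \<mu> \<sigma> p \<alpha> (f x) (g x) (h x)) \<in> borel_measurable K"
    if "f \<in> borel_measurable K" "g \<in> borel_measurable K" "h \<in> borel_measurable K"
    for f g h and K :: "'b measure"
    using that unfolding GAL_map_def by measurable
  have "emeasure (GAL \<mu> \<sigma> p \<alpha>) {..y} = (\<integral>\<^sup>+x. indicator {..y} x \<partial>GAL \<mu> \<sigma> p \<alpha>)"
    by (subst nn_integral_indicator) (simp_all add: GAL_def)
  also have "\<dots> = (\<integral>\<^sup>+(w, s, u). ?I w s u \<partial>(?E \<Otimes>\<^sub>M (?H \<Otimes>\<^sub>M ?N)))"
    unfolding GAL_def by (subst nn_integral_distr) (auto simp: case_prod_unfold)
  also have "\<dots> = (\<integral>\<^sup>+w. \<integral>\<^sup>+(s, u). ?I w s u \<partial>(?H \<Otimes>\<^sub>M ?N) \<partial>?E)"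
    by (subst HN.nn_integral_fst[symmetric]) (auto simp: case_prod_unfold)
  also have "\<dots> = (\<integral>\<^sup>+w. \<integral>\<^sup>+s. \<integral>\<^sup>+u. ?I w s u \<partial>?N \<partial>?H \<partial>?E)"
    by (subst N.nn_integral_fst[symmetric]) (auto simp: case_prod_unfold)
  \<comment> \<open>Moving S outermost leaves W and U together inside, where their combined law is
    known.\<close>
  also have "\<dots> = (\<integral>\<^sup>+s. \<integral>\<^sup>+w. \<integral>\<^sup>+u. ?I w s u \<partial>?N \<partial>?E \<partial>?H)"
    by (rule EH.Fubini'[symmetric]) (auto simp: case_prod_unfold)
  also have "\<dots> = (\<integral>\<^sup>+s. ennreal (asym_laplace_cdf p ((y - \<mu>) / \<sigma> - \<alpha> * s)) \<partial>?H)"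
  proof (rule nn_integral_cong)
    fix s
    let ?x = "(y - \<mu>) / \<sigma> - \<alpha> * s"
    have I: "?I w s u = indicator {..?x} (?g (w, u))" for w u
    proof -
      have "GAL_map \<mu> \<sigma> p \<alpha> w s u = \<mu> + \<sigma> * (?g (w, u) + \<alpha> * s)"
        by (simp add: GAL_map_def algebra_simps)
      then have "GAL_map \<mu> \<sigma> p \<alpha> w s u \<le> y \<longleftrightarrow> ?g (w, u) \<le> ?x"
        using \<sigma> by (simp add: field_simps)
      then show ?thesis by (simp add: indicator_def)
    qed
    have "(\<integral>\<^sup>+w. \<integral>\<^sup>+u. ?I w s u \<partial>?N \<partial>?E) = (\<integral>\<^sup>+z. indicator {..?x} (?g z) \<partial>(?E \<Otimes>\<^sub>M ?N))"
      unfolding I by (rule N.nn_integral_fst) measurable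
    also have "\<dots> = (\<integral>\<^sup>+v. indicator {..?x} v \<partial>exponential_normal_mixture p)"
      unfolding exponential_normal_mixture_def by (subst nn_integral_distr) auto
    also have "\<dots> = emeasure (density lborel (asym_laplace_density p)) {..?x}"
      by (simp add: exponential_normal_mixture_eq p)
    also have "\<dots> = ennreal (asym_laplace_cdf p ?x)"
    proof -
      interpret L: real_distribution "density lborel (asym_laplace_density p)"
        using p by (rule real_distribution_asym_laplace)
      show ?thesis
        by (simp add: L.emeasure_eq_measure measure_asym_laplace_atMost p)
    qed
    finally show "(\<integral>\<^sup>+w. \<integral>\<^sup>+u. ?I w s u \<partial>?N \<partial>?E) = ennreal (asym_laplace_cdf p ?x)" .
  qed
  also have "\<dots> = (\<integral>\<^sup>+s. ennreal (half_normal_density s * asym_laplace_cdf p ((y - \<mu>) / \<sigma> - \<alpha> * s)) \<partial>lborel)"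
    by (subst nn_integral_density) (auto simp: ennreal_mult' half_normal_density_nonneg)
  finally show ?thesis .
qed

section \<open>Evaluation of the distribution function\<close>

text \<open>Both branches have the form constant minus p(1 - p)/q times exp(-x q), with q = p on the
  right and q = p - 1 on the left. Sorting them by the sign of x/\<alpha> treats both signs of
  \<alpha> at once and produces the q of the theorem.\<close>

lemma asym_laplace_cdf_signed:
  assumes "0 < p" "p < 1" "\<alpha> \<noteq> 0"
  shows "x / \<alpha> \<le> 0 \<Longrightarrow> asym_laplace_cdf p x =
      of_bool (\<alpha> < 0) - p * (1 - p) / (p - of_bool (\<alpha> > 0)) * exp (- x * (p - of_bool (\<alpha> > 0)))"
    and "x / \<alpha> > 0 \<Longrightarrow> asym_laplace_cdf p x =
      of_bool (\<alpha> > 0) - p * (1 - p) / (p - of_bool (\<alpha> < 0)) * exp (- x * (p - of_bool (\<alpha> < 0)))"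
proof -
  have *: "p * (1 - p) / (p - 1) = - p"
    using assms by (simp add: field_simps)
  \<comment> \<open>At x = 0 the definition takes the right branch; both branches equal p
    there.\<close>
  have neg: "asym_laplace_cdf p x = - (p * (1 - p) / (p - 1)) * exp (- x * (p - 1))" if "x \<le> 0"
    unfolding * using that by (cases "x = 0") (simp_all add: asym_laplace_cdf_def algebra_simps)
  have pos: "asym_laplace_cdf p x = 1 - p * (1 - p) / p * exp (- x * p)" if "x \<ge> 0"
    using that assms by (simp add: asym_laplace_cdf_def mult.commute)
  show "asym_laplace_cdf p x =
      of_bool (\<alpha> < 0) - p * (1 - p) / (p - of_bool (\<alpha> > 0)) * exp (- x * (p - of_bool (\<alpha> > 0)))"
    if "x / \<alpha> \<le> 0"
  proof (cases "\<alpha> > 0")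
    case True
    then have "x \<le> 0" using that by (simp add: divide_le_0_iff)
    then show ?thesis using True by (simp add: neg)
  next
    case False
    then have "\<alpha> < 0" using assms by simp
    then have "x \<ge> 0" using that by (simp add: divide_le_0_iff)
    then show ?thesis using False \<open>\<alpha> < 0\<close> by (simp add: pos)
  qed
  show "asym_laplace_cdf p x =
      of_bool (\<alpha> > 0) - p * (1 - p) / (p - of_bool (\<alpha> < 0)) * exp (- x * (p - of_bool (\<alpha> < 0)))"
    if "x / \<alpha> > 0"
  proof (cases "\<alpha> > 0")
    case True
    then have "x \<ge> 0" using that by (simp add: zero_less_divide_iff)
    then show ?thesis using True by (simp add: pos)
  next
    case False
    then have "\<alpha> < 0" using assms by simp
    then have "x \<le> 0" using that by (simp add: zero_less_divide_iff)
    then show ?thesis using False \<open>\<alpha> < 0\<close> by (simp add: neg)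
  qed
qed

theorem theorem2:
  fixes M :: "'a measure" and Y :: "'a \<Rightarrow> real"
    and \<mu> \<sigma> p \<alpha> y ystar p_plus p_minus :: real
  assumes "prob_space M"
    and "Y \<in> borel_measurable M"
    and "\<sigma> > 0" and "0 < p" and "p < 1" and "\<alpha> \<noteq> 0"
    and "distr M borel Y = GAL \<mu> \<sigma> p \<alpha>"
    and "ystar = (y - \<mu>) / \<sigma>"
    and "p_plus = p - of_bool (\<alpha> > 0)"
    and "p_minus = p - of_bool (\<alpha> < 0)"
  shows "cdf (distr M borel Y) y =
     (1 - 2 * Phi (- (ystar / \<bar>\<alpha>\<bar>))
        - 2 * p * (1 - p) / p_minus
          * exp (- ystar * p_minus + 1 / 2 * \<alpha>\<^sup>2 * p_minus\<^sup>2)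
          * (Phi (ystar / \<alpha> - \<alpha> * p_minus) - Phi (- \<alpha> * p_minus)))
       * of_bool (ystar / \<alpha> > 0)
     + of_bool (\<alpha> < 0)
     - 2 * p * (1 - p) / p_plus
       * exp (- ystar * p_plus + 1 / 2 * \<alpha>\<^sup>2 * p_plus\<^sup>2)
       * Phi (\<alpha> * p_plus - ystar / \<alpha> * of_bool (ystar / \<alpha> > 0))"
    (is "_ = ?rhs")
proof -
  \<comment> \<open>\<tau> is the value of s at which \<open>ystar - \<alpha> * s\<close> changes
    sign, and \<open>t\<close> is this threshold clipped to the support of S. \<open>G\<close> is
    the integrand, \<open>k q\<close> the coefficient of \<open>exp (\<alpha> * q * s)\<close> in
    it, and \<open>T'\<close> the integral of \<open>T\<close>.\<close>
  define \<tau> where "\<tau> = ystar / \<alpha>"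
  define t where "t = max 0 \<tau>"
  define G where "G s = half_normal_density s * asym_laplace_cdf p (ystar - \<alpha> * s)" for s
  define k where "k q = p * (1 - p) / q * exp (- ystar * q)" for q
  define T where "T a b s = indicator {a..} s * (exp (b * s) * std_normal_density s)" for a b s
  define T' where "T' a b = exp (b\<^sup>2 / 2) * Phi (b - a)" for a b
  have T: "has_bochner_integral lborel (T a b) (T' a b)" for a b
    unfolding T_def T'_def by (rule has_bochner_integral_tilted_std_normal_tail)
  \<comment> \<open>The first line covers s beyond the threshold. The interval from 0 to \<tau>,
    present only if \<tau> > 0, is written as a difference of two tails, so that \<open>?V\<close>
    arises by replacing each \<open>T\<close> with \<open>T'\<close>.\<close>
  let ?h = "\<lambda>s. 2 * (of_bool (\<alpha> < 0) * T t 0 s - k p_plus * T t (\<alpha> * p_plus) s)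
     + of_bool (\<tau> > 0) * (2 * (of_bool (\<alpha> > 0) * (T 0 0 s - T \<tau> 0 s)
         - k p_minus * (T 0 (\<alpha> * p_minus) s - T \<tau> (\<alpha> * p_minus) s)))"
  let ?V = "2 * (of_bool (\<alpha> < 0) * T' t 0 - k p_plus * T' t (\<alpha> * p_plus))
     + of_bool (\<tau> > 0) * (2 * (of_bool (\<alpha> > 0) * (T' 0 0 - T' \<tau> 0)
         - k p_minus * (T' 0 (\<alpha> * p_minus) - T' \<tau> (\<alpha> * p_minus))))"
  \<comment> \<open>The point 0 is excluded because the tails in \<open>?h\<close> are closed, while
    \<open>half_normal_density\<close> vanishes at 0.\<close>
  have G0: "G s = ?h s" if "s \<noteq> 0" for s
  proof (cases "s > 0")
    case False
    then show ?thesis using that by (simp add: G_def T_def t_def half_normal_density_def)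
  next
    case True
    have E: "p * (1 - p) / q * exp (- (ystar - \<alpha> * s) * q) = k q * exp (\<alpha> * q * s)" for q
      by (simp add: k_def algebra_simps flip: exp_add)
    have \<tau>s: "(ystar - \<alpha> * s) / \<alpha> = \<tau> - s"
      using \<open>\<alpha> \<noteq> 0\<close> by (simp add: \<tau>_def diff_divide_distrib)
    show ?thesis
    proof (cases "s \<ge> \<tau>")
      case le: True
      then have cdf: "asym_laplace_cdf p (ystar - \<alpha> * s) = of_bool (\<alpha> < 0) - k p_plus * exp (\<alpha> * p_plus * s)"
        using asym_laplace_cdf_signed(1)[OF \<open>0 < p\<close> \<open>p < 1\<close> \<open>\<alpha> \<noteq> 0\<close>, of "ystar - \<alpha> * s"]
        unfolding \<tau>s E assms(9)[symmetric] by simp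
      show ?thesis
        unfolding G_def cdf using le True by (simp add: half_normal_density_eq T_def t_def algebra_simps)
    next
      case False
      then have cdf: "asym_laplace_cdf p (ystar - \<alpha> * s) = of_bool (\<alpha> > 0) - k p_minus * exp (\<alpha> * p_minus * s)"
        using asym_laplace_cdf_signed(2)[OF \<open>0 < p\<close> \<open>p < 1\<close> \<open>\<alpha> \<noteq> 0\<close>, of "ystar - \<alpha> * s"]
        unfolding \<tau>s E assms(10)[symmetric] by simp
      show ?thesis
        unfolding G_def cdf using False True by (simp add: half_normal_density_eq T_def t_def algebra_simps)
    qed
  qed
  have "has_bochner_integral lborel ?h ?V"
    by (intro has_bochner_integral_add has_bochner_integral_diff has_bochner_integral_mult_right T)
  then have "has_bochner_integral lborel G ?V"
    by (rule has_bochner_integral_discrete_difference[where X="{0}", THEN iffD1, rotated -1])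
      (use G0 in auto)
  \<comment> \<open>Nonnegativity identifies the extended integral with \<open>ennreal ?V\<close>
    and gives \<open>?V \<ge> 0\<close>, so that passing back to a real measure returns
    \<open>?V\<close> itself.\<close>
  moreover have "G s \<ge> 0" for s
    using assms(4,5) mult_left_le_one_le[of "1 - p"] mult_le_one[of "1 - p" "exp (- p * (ystar - \<alpha> * s))"]
    by (auto simp: G_def half_normal_density_nonneg asym_laplace_cdf_def intro!: mult_nonneg_nonneg)
  ultimately have "(\<integral>\<^sup>+s. ennreal (G s) \<partial>lborel) = ennreal ?V" and "?V \<ge> 0"
    using Bochner_Integration.integral_nonneg[of lborel G] by (auto simp: nn_integral_eq_integral has_bochner_integral_iff)
  moreover have "emeasure (distr M borel Y) {..y} = (\<integral>\<^sup>+s. ennreal (G s) \<partial>lborel)"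
    using emeasure_GAL_atMost[OF assms(4,5,3)] by (simp add: assms(7,8) G_def)
  ultimately have "cdf (distr M borel Y) y = ?V"
    by (simp add: cdf_def measure_def)
  also have "?V = ?rhs"
  proof -
    have k: "k q * T' a (\<alpha> * q) = p * (1 - p) / q * exp (- ystar * q + 1 / 2 * \<alpha>\<^sup>2 * q\<^sup>2) * Phi (\<alpha> * q - a)" for q a
      by (simp add: k_def T'_def power_mult_distrib flip: exp_add)
    \<comment> \<open>Symmetry of \<open>Phi\<close>, applied to both terms, gives the arguments the
      signs they have in the theorem.\<close>
    have d: "Phi (\<alpha> * q - 0) - Phi (\<alpha> * q - \<tau>) = Phi (\<tau> - \<alpha> * q) - Phi (- \<alpha> * q)" for q
      using Phi_minus[of "\<alpha> * q - \<tau>"] Phi_minus[of "\<alpha> * q"] by simp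
    have t: "t = \<tau> * of_bool (\<tau> > 0)" by (auto simp: t_def)
    have m: "k p_minus * (T' 0 (\<alpha> * p_minus) - T' \<tau> (\<alpha> * p_minus)) =
       p * (1 - p) / p_minus * exp (- ystar * p_minus + 1 / 2 * \<alpha>\<^sup>2 * p_minus\<^sup>2)
         * (Phi (\<tau> - \<alpha> * p_minus) - Phi (- \<alpha> * p_minus))"
      unfolding right_diff_distrib k d[symmetric] ..
    \<comment> \<open>The terms without an exponential. If \<tau> > 0, they give 1 - 2 Phi(-\<tau>)
      for \<alpha> > 0 and 2 Phi(-\<tau>) = 2 - 2 Phi(\<tau>) for \<alpha> < 0; the absolute value
      of \<alpha> merges the two cases.\<close>
    have z: "2 * (of_bool (\<alpha> < 0) * T' t 0) + of_bool (\<tau> > 0) * (2 * (of_bool (\<alpha> > 0) * (T' 0 0 - T' \<tau> 0)))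
       = (1 - 2 * Phi (- (ystar / \<bar>\<alpha>\<bar>))) * of_bool (\<tau> > 0) + of_bool (\<alpha> < 0)"
      using \<open>\<alpha> \<noteq> 0\<close> Phi_minus[of "ystar / \<alpha>"]
      by (cases "\<alpha> > 0"; cases "\<tau> > 0") (auto simp: T'_def t Phi_0 \<tau>_def)
    have "?V = 2 * (of_bool (\<alpha> < 0) * T' t 0) + of_bool (\<tau> > 0) * (2 * (of_bool (\<alpha> > 0) * (T' 0 0 - T' \<tau> 0)))
       - 2 * (k p_plus * T' t (\<alpha> * p_plus))
       - of_bool (\<tau> > 0) * (2 * (k p_minus * (T' 0 (\<alpha> * p_minus) - T' \<tau> (\<alpha> * p_minus))))"
      by (simp only: right_diff_distrib)
    also have "\<dots> = ?rhs"
      unfolding z k m \<tau>_def[symmetric] t[symmetric] by (simp add: left_diff_distrib)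
    finally show ?thesis .
  qed
  finally show ?thesis .
qed

end
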